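(* Let $R=k[x,y,z]$, and let $X=V(f)\subseteq \mathbb{P}_k^2$ be a reduced singular cubic curve. Then the following are equivalent: (a) $X$ is Veronese-Avoiding; (b) $X$ is nodal.
   Context: $k$ is an algebraically closed field of characteristic zero. More generally, for $R=k[x_1,\ldots,x_n]$ standard graded with graded pieces $R_m$ and $f\in R_d$ a reduced (squarefree) homogeneous polynomial of degree $d\ge3$, the gradient ideal is $J_f=(\partial f/\partial x_1,\ldots,\partial f/\partial x_n)$, with degree-$m$ piece $(J_f)_m\subseteq R_m$, and $T=n(d-2)$. $\mathbb{P}((J_f)_m)\subseteq\mathbb{P}(R_m)$ is the projective linear subspace attached to $(J_f)_m$, of codimension $\dim_k R_m-\dim_k (J_f)_m$. The Veronese variety $V_n^m\subseteq \mathbb{P}(R_m)$ is the image of $\mathbb{P}(R_1)\to\mathbb{P}(R_m)$, $[\ell]\mapsto[\ell^m]$. The hypersurface $X=V(f)\subseteq\mathbb{P}_k^{n-1}$ is called Veronese-Avoiding if (I) $\mathrm{codim}_{\mathbb{P}(R_{T-1})}\mathbb{P}((J_f)_{T-1})=n$ and (II) $\mathbb{P}((J_f)_{T-1})\cap V_n^{T-1}=\emptyset$. Here $n=d=3$, so $T-1=2$. A curve is nodal if all its singular points are nodes, i.e. ordinary double points (the quadratic part of a local equation at the point is a nondegenerate quadratic form). *)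

theory Defs
  imports
    "HOL-Analysis.Finite_Cartesian_Product"
    "HOL-Library.Poly_Mapping"
    "HOL-Library.Numeral_Type"
    "HOL-Computational_Algebra.Polynomial"
    "HOL-Computational_Algebra.Squarefree"
begin

section \<open>The polynomial ring in variables indexed by a finite type\<close>

text \<open>
  A monomial is its exponent vector. The ring structure is the convolution product of
  \<^theory>\<open>HOL-Library.Poly_Mapping\<close>; the number of variables \<open>n\<close> is \<open>CARD('n)\<close>.
\<close>

type_synonym ('n, 'k) mpoly = "('n \<Rightarrow>\<^sub>0 nat) \<Rightarrow>\<^sub>0 'k"

definition Const :: "'k::zero \<Rightarrow> ('n::finite, 'k) mpoly" where
  "Const c = Poly_Mapping.single 0 c"

definition Var :: "'n::finite \<Rightarrow> ('n, 'k::zero_neq_one) mpoly" where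
  "Var i = Poly_Mapping.single (Poly_Mapping.single i 1) 1"

definition mon_degree :: "('n::finite \<Rightarrow>\<^sub>0 nat) \<Rightarrow> nat" where
  "mon_degree m = (\<Sum>i\<in>UNIV. Poly_Mapping.lookup m i)"

text \<open>The zero polynomial is homogeneous of every degree.\<close>

definition homogeneous :: "nat \<Rightarrow> ('n::finite, 'k::zero) mpoly \<Rightarrow> bool" where
  "homogeneous d f \<longleftrightarrow> (\<forall>m\<in>Poly_Mapping.keys f. mon_degree m = d)"

definition graded_piece :: "nat \<Rightarrow> ('n::finite, 'k::zero) mpoly set" where
  "graded_piece m = {f. homogeneous m f}"

definition homogeneous_part :: "nat \<Rightarrow> ('n::finite, 'k::comm_monoid_add) mpoly \<Rightarrow> ('n, 'k) mpoly" where
  "homogeneous_part d f =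
     (\<Sum>m | m \<in> Poly_Mapping.keys f \<and> mon_degree m = d.
        Poly_Mapping.single m (Poly_Mapping.lookup f m))"

text \<open>
  Apply \<open>\<phi>\<close> to the coefficients and replace the variable \<open>i\<close> by \<open>s i\<close>.
\<close>

definition insertion :: "('k::zero \<Rightarrow> 'b::comm_semiring_1) \<Rightarrow> ('n::finite \<Rightarrow> 'b) \<Rightarrow> ('n, 'k) mpoly \<Rightarrow> 'b" where
  "insertion \<phi> s f =
     (\<Sum>m\<in>Poly_Mapping.keys f.
        \<phi> (Poly_Mapping.lookup f m) * (\<Prod>i\<in>UNIV. s i ^ Poly_Mapping.lookup m i))"

definition eval_at :: "('n::finite, 'k::comm_semiring_1) mpoly \<Rightarrow> 'k ^ 'n \<Rightarrow> 'k" where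
  "eval_at f p = insertion (\<lambda>c. c) (\<lambda>i. p $ i) f"

text \<open>
  The subtraction of exponents truncates only where the coefficient is zero.
\<close>

definition partial :: "'n::finite \<Rightarrow> ('n, 'k::comm_semiring_1) mpoly \<Rightarrow> ('n, 'k) mpoly" where
  "partial i f =
     (\<Sum>m\<in>Poly_Mapping.keys f.
        Poly_Mapping.single (m - Poly_Mapping.single i 1)
          (of_nat (Poly_Mapping.lookup m i) * Poly_Mapping.lookup f m))"

definition scale :: "'k::field \<Rightarrow> ('n::finite, 'k) mpoly \<Rightarrow> ('n, 'k) mpoly" where
  "scale c f = Const c * f"

interpretation mpoly: vector_space "scale :: 'k::field \<Rightarrow> ('n::finite, 'k) mpoly \<Rightarrow> ('n, 'k) mpoly"
  by unfold_locales
    (simp_all add: scale_def Const_def algebra_simps single_add mult_single flip: mult.assoc)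

section \<open>Veronese-Avoiding hypersurfaces\<close>

text \<open>
  An ideal of a commutative ring is a submodule of the ring, so the ideal generated by a set is
  its span for the multiplication of the ring.
\<close>

definition gradient_ideal :: "('n::finite, 'k::comm_ring_1) mpoly \<Rightarrow> ('n, 'k) mpoly set" where
  "gradient_ideal f = module.span (*) (range (\<lambda>i. partial i f))"

text \<open>
  A point of a projective space is a line through the origin, as a set of vectors.
\<close>

definition projectivization :: "('n::finite, 'k::field) mpoly set \<Rightarrow> ('n, 'k) mpoly set set" where
  "projectivization W = {mpoly.span {w} | w. w \<in> W \<and> w \<noteq> 0}"

definition codim :: "('n::finite, 'k::field) mpoly set \<Rightarrow> ('n, 'k) mpoly set \<Rightarrow> int" where
  "codim V W = int (mpoly.dim V) - int (mpoly.dim W)"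

definition veronese :: "nat \<Rightarrow> ('n::finite, 'k::field) mpoly set set" where
  "veronese m = {mpoly.span {l ^ m} | l. l \<in> graded_piece 1 \<and> l \<noteq> 0}"

text \<open>
  The parameter \<open>d\<close> is the degree of the form \<open>f\<close>; the notion is meant for reduced \<open>f\<close>
  and \<open>d \<ge> 3\<close>, for which \<open>T - 1\<close> does not truncate.
\<close>

definition veronese_avoiding :: "nat \<Rightarrow> ('n::finite, 'k::field) mpoly \<Rightarrow> bool" where
  "veronese_avoiding d f \<longleftrightarrow>
     (let T = CARD('n) * (d - 2);
          R = graded_piece (T - 1);
          J = gradient_ideal f \<inter> graded_piece (T - 1)
      in codim R J = int CARD('n) \<and> projectivization J \<inter> veronese (T - 1) = {})"

section \<open>Singular points and nodes of projective hypersurfaces\<close>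

text \<open>
  Points of projective space are represented by their nonzero vectors of homogeneous coordinates.
\<close>

definition singular_point :: "('n::finite, 'k::field) mpoly \<Rightarrow> 'k ^ 'n \<Rightarrow> bool" where
  "singular_point f p \<longleftrightarrow>
     p \<noteq> 0 \<and> eval_at f p = 0 \<and> (\<forall>i. eval_at (partial i f) p = 0)"

definition singular :: "('n::finite, 'k::field) mpoly \<Rightarrow> bool" where
  "singular f \<longleftrightarrow> (\<exists>p. singular_point f p)"

text \<open>
  The equation of the hypersurface in the affine chart \<open>x\<^sub>i = 1\<close>, translated so that \<open>p\<close> becomes the
  origin. It does not involve the variable \<open>i\<close>: the affine coordinates are the \<open>Var j\<close> with \<open>j \<noteq> i\<close>.
\<close>

definition local_equation :: "'n::finite \<Rightarrow> 'k ^ 'n \<Rightarrow> ('n, 'k::field) mpoly \<Rightarrow> ('n, 'k) mpoly" where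
  "local_equation i p f =
     insertion Const (\<lambda>j. if j = i then 1 else Var j + Const (p $ j / p $ i)) f"

definition polar_form :: "('n::finite, 'k::field) mpoly \<Rightarrow> 'k ^ 'n \<Rightarrow> 'k ^ 'n \<Rightarrow> 'k" where
  "polar_form q u v = eval_at q (u + v) - eval_at q u - eval_at q v"

text \<open>
  Nondegeneracy of a quadratic form \<open>q\<close> in the variables \<open>j \<noteq> i\<close>; the space it lives on is
  identified with the hyperplane \<open>u\<^sub>i = 0\<close>.
\<close>

definition nondegenerate_off :: "'n::finite \<Rightarrow> ('n, 'k::field) mpoly \<Rightarrow> bool" where
  "nondegenerate_off i q \<longleftrightarrow>
     (\<forall>u. u $ i = 0 \<and> (\<forall>v. v $ i = 0 \<longrightarrow> polar_form q u v = 0) \<longrightarrow> u = 0)"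

text \<open>
  At a singular point the local equations in two charts containing it have the same quadratic part
  up to a linear change of coordinates and a nonzero factor, so the choice of chart does not matter.
\<close>

definition node :: "('n::finite, 'k::field) mpoly \<Rightarrow> 'k ^ 'n \<Rightarrow> bool" where
  "node f p \<longleftrightarrow>
     singular_point f p \<and>
     (\<exists>i. p $ i \<noteq> 0 \<and> nondegenerate_off i (homogeneous_part 2 (local_equation i p f)))"

definition nodal :: "('n::finite, 'k::field) mpoly \<Rightarrow> bool" where
  "nodal f \<longleftrightarrow> (\<forall>p. singular_point f p \<longrightarrow> node f p)"

end

theory Submission
  imports Defs "HOL-Analysis.Cartesian_Space"
begin

text \<open>
  In characteristic zero a cubic is \<open>f(x) = F(x, x, x)\<close> for a symmetric trilinear form \<open>F\<close>, and all
  the geometric data are read off from \<open>F\<close>. The derivative of \<open>f\<close> in the direction \<open>v\<close> is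
  \<open>3 F(v, x, x)\<close>. A point \<open>p \<noteq> 0\<close> is singular if \<open>F(p, p, \<cdot>) = 0\<close>, and a singular point \<open>p\<close> is a
  node if the kernel of the bilinear form \<open>F(p, \<cdot>, \<cdot>)\<close> is the line spanned by \<open>p\<close>
  (\<open>node_cubic_form_iff\<close>). As \<open>T - 1 = 2\<close> is the degree of the partial derivatives, the gradient ideal
  has the directional derivatives as its piece of degree \<open>T - 1\<close>, and \<open>f\<close> is Veronese-Avoiding if and
  only if no derivative in a direction \<open>v \<noteq> 0\<close> is the square of a possibly vanishing linear form
  (\<open>veronese_avoiding_3_iff\<close>): zero is excluded by condition (I), nonzero squares by condition (II).

  A singular point \<open>p\<close> that is not a node makes \<open>F(p, \<cdot>, \<cdot>)\<close> a symmetric form on a space of dimension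
  three whose kernel has dimension at least two, so over an algebraically closed field \<open>3 F(p, x, x)\<close> is
  a square (\<open>nonnode_directional_is_square\<close>), and \<open>f\<close> is not Veronese-Avoiding.

  Conversely, let \<open>3 F(v, x, x) = l(x)\<^sup>2\<close> with \<open>v \<noteq> 0\<close>. Either \<open>l(v) = 0\<close>, and then \<open>v\<close> is itself a
  singular point and not a node, as for a cusp; or \<open>l(v) \<noteq> 0\<close>, and then every singular point \<open>p\<close> lies
  on the line \<open>l = 0\<close> and has \<open>v\<close> as a further kernel vector of \<open>F(p, \<cdot>, \<cdot>)\<close>
  (\<open>square_directional_imp_nonnode\<close>). The second case needs a singular point to start from: the smooth
  Fermat cubic is not Veronese-Avoiding.
\<close>

section \<open>Polynomials as sums of monomials\<close>

lemma poly_eq_sum_monomials: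
  "f = (\<Sum>m\<in>Poly_Mapping.keys f. Poly_Mapping.single m (Poly_Mapping.lookup f m))"
proof (rule poly_mapping_eqI)
  fix k
  have "Poly_Mapping.lookup (\<Sum>m\<in>Poly_Mapping.keys f. Poly_Mapping.single m (Poly_Mapping.lookup f m)) k
    = (\<Sum>m\<in>Poly_Mapping.keys f. if m = k then Poly_Mapping.lookup f m else 0)"
    by (simp add: lookup_sum lookup_single when_def)
  also have "\<dots> = Poly_Mapping.lookup f k"
    by (simp add: in_keys_iff)
  finally show "Poly_Mapping.lookup f k =
    Poly_Mapping.lookup (\<Sum>m\<in>Poly_Mapping.keys f. Poly_Mapping.single m (Poly_Mapping.lookup f m)) k"
    by simp
qed

lemma poly_monomial_induct [case_names monomial add]:
  fixes P :: "('a \<Rightarrow>\<^sub>0 'b::comm_monoid_add) \<Rightarrow> bool"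
  assumes "\<And>m c. P (Poly_Mapping.single m c)"
    and "\<And>f g. P f \<Longrightarrow> P g \<Longrightarrow> P (f + g)"
  shows "P f"
proof -
  have zero: "P 0"
    using assms(1)[of undefined 0] by simp
  have "P (\<Sum>m\<in>A. Poly_Mapping.single m (c m))" if "finite A" for A c
    using that by (induction A rule: finite_induct) (simp_all add: zero assms)
  then show ?thesis
    by (subst poly_eq_sum_monomials) simp
qed

lemma Const_0: "Const 0 = 0"
  and Const_1: "Const 1 = 1"
  and Const_add: "Const (a + b) = Const a + Const b"
  by (simp_all add: Const_def single_add)

lemma Const_mult: "Const (a * b) = Const a * Const (b :: 'k::comm_semiring_1)"
  by (simp add: Const_def mult_single)

lemma Const_numeral: "Const (numeral n :: 'k::comm_semiring_1) = numeral n"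
  by (induction n) (simp_all only: numeral.simps Const_add Const_1)

lemma Const_3_mult: "Const (3 :: 'k::comm_semiring_1) * f = f + f + f"
proof -
  have "(3 :: 'k) = 1 + 1 + 1" by simp
  then show ?thesis
    by (simp only: Const_add Const_1 distrib_right mult_1_left)
qed

lemma Const_sum: "Const (sum c A) = (\<Sum>a\<in>A. Const (c a))"
  by (induction A rule: infinite_finite_induct) (simp_all add: Const_0 Const_add)

lemma Const_mult_single:
  "Const c * Poly_Mapping.single m (d :: 'k::comm_semiring_1) = Poly_Mapping.single m (c * d)"
  by (simp add: Const_def mult_single)

lemma mon_degree_add: "mon_degree (m + m') = mon_degree m + mon_degree m'"
  by (simp add: mon_degree_def lookup_add sum.distrib)

lemma mon_degree_single: "mon_degree (Poly_Mapping.single i k) = k"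
  by (simp add: mon_degree_def lookup_single when_def)

lemma mon_degree_0_iff: "mon_degree m = 0 \<longleftrightarrow> m = 0"
  by (auto simp: mon_degree_def poly_mapping_eq_iff fun_eq_iff)

lemma mon_degree_SucE:
  assumes "mon_degree m = Suc d"
  obtains i m' where "m = Poly_Mapping.single i 1 + m'" "mon_degree m' = d"
proof -
  from assms have "m \<noteq> 0"
    using mon_degree_0_iff[of m] by auto
  then obtain i where i: "Poly_Mapping.lookup m i \<noteq> 0"
    by (auto simp: poly_mapping_eq_iff fun_eq_iff)
  define m' where "m' = m - Poly_Mapping.single i 1"
  have m: "m = Poly_Mapping.single i 1 + m'"
    using i by (auto simp: m'_def poly_mapping_eq_iff fun_eq_iff lookup_add lookup_minus
        lookup_single when_def)
  have "mon_degree m' = d"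
    using assms by (subst (asm) m) (simp add: mon_degree_add mon_degree_single)
  with m show ?thesis
    by (rule that)
qed

section \<open>Substitution and differentiation\<close>

lemma insertion_superset:
  assumes "\<phi> 0 = 0" "finite A" "Poly_Mapping.keys f \<subseteq> A"
  shows "insertion \<phi> s f =
    (\<Sum>m\<in>A. \<phi> (Poly_Mapping.lookup f m) * (\<Prod>i\<in>UNIV. s i ^ Poly_Mapping.lookup m i))"
  unfolding insertion_def using assms
  by (intro sum.mono_neutral_left) (auto simp: in_keys_iff)

lemma insertion_single:
  assumes "\<phi> 0 = 0"
  shows "insertion \<phi> s (Poly_Mapping.single m c) = \<phi> c * (\<Prod>i\<in>UNIV. s i ^ Poly_Mapping.lookup m i)"
  using assms by (subst insertion_superset[where A = "{m}"]) (auto simp: lookup_single split: if_splits)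

lemma insertion_add:
  assumes "\<phi> 0 = 0" "\<And>x y. \<phi> (x + y) = \<phi> x + \<phi> y"
  shows "insertion \<phi> s (f + g) = insertion \<phi> s f + insertion \<phi> s g"
proof -
  let ?A = "Poly_Mapping.keys f \<union> Poly_Mapping.keys g"
  have "Poly_Mapping.keys (f + g) \<subseteq> ?A"
    by (rule Poly_Mapping.keys_add)
  then show ?thesis
    using assms by (simp add: insertion_superset[where A = ?A] lookup_add distrib_right sum.distrib)
qed

lemma insertion_mult:
  assumes "\<phi> 0 = 0" "\<And>x y. \<phi> (x + y) = \<phi> x + \<phi> y" "\<And>x y. \<phi> (x * y) = \<phi> x * \<phi> y"
  shows "insertion \<phi> s (f * g) = insertion \<phi> s f * insertion \<phi> s g"
proof (induction f rule: poly_monomial_induct)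
  case (monomial m c)
  show ?case
    by (induction g rule: poly_monomial_induct)
      (simp_all add: assms mult_single insertion_single lookup_add power_add prod.distrib
        algebra_simps insertion_add)
qed (simp add: distrib_right insertion_add assms)

lemma insertion_Const: "\<phi> 0 = 0 \<Longrightarrow> insertion \<phi> s (Const c) = \<phi> c"
  by (simp add: Const_def insertion_single)

lemma insertion_Var:
  assumes "\<phi> 0 = 0" "\<phi> 1 = 1"
  shows "insertion \<phi> s (Var i) = s i"
proof -
  have "(\<Prod>j\<in>UNIV. s j ^ Poly_Mapping.lookup (Poly_Mapping.single i (1::nat)) j)
    = (\<Prod>j\<in>UNIV. if j = i then s j else 1)"
    by (rule prod.cong) (auto simp: lookup_single)
  with assms show ?thesis
    by (simp add: Var_def insertion_single)
qed

lemma eval_at_add: "eval_at (f + g) p = eval_at f p + eval_at g p"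
  and eval_at_mult: "eval_at (f * g) p = eval_at f p * eval_at g p"
  and eval_at_Const: "eval_at (Const c) p = c"
  and eval_at_Var: "eval_at (Var i) p = p $ i"
  and eval_at_0: "eval_at 0 p = 0"
  by (simp_all add: eval_at_def insertion_add insertion_mult insertion_Const insertion_Var)
    (simp add: insertion_def)

lemma eval_at_sum: "eval_at (sum f A) p = (\<Sum>a\<in>A. eval_at (f a) p)"
  by (induction A rule: infinite_finite_induct) (simp_all add: eval_at_add eval_at_0)

lemma partial_superset:
  assumes "finite A" "Poly_Mapping.keys f \<subseteq> A"
  shows "partial i f = (\<Sum>m\<in>A. Poly_Mapping.single (m - Poly_Mapping.single i 1)
    (of_nat (Poly_Mapping.lookup m i) * Poly_Mapping.lookup f m))"
  unfolding partial_def using assms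
  by (intro sum.mono_neutral_left) (auto simp: in_keys_iff)

lemma partial_single:
  "partial i (Poly_Mapping.single m c) =
    Poly_Mapping.single (m - Poly_Mapping.single i 1) (of_nat (Poly_Mapping.lookup m i) * c)"
  by (subst partial_superset[where A = "{m}"]) (auto split: if_splits)

lemma partial_add: "partial i (f + g) = partial i f + partial i g"
proof -
  let ?A = "Poly_Mapping.keys f \<union> Poly_Mapping.keys g"
  have "Poly_Mapping.keys (f + g) \<subseteq> ?A"
    by (rule Poly_Mapping.keys_add)
  then show ?thesis
    by (simp add: partial_superset[where A = ?A] lookup_add distrib_left sum.distrib single_add)
qed

lemma partial_Const: "partial i (Const c) = 0"
  by (simp add: Const_def partial_single)

lemma partial_Var: "partial i (Var j) = (if j = i then 1 else 0)"
  by (simp add: Var_def partial_single lookup_single when_def)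

lemma partial_sum: "partial i (sum f A) = (\<Sum>a\<in>A. partial i (f a))"
  by (induction A rule: infinite_finite_induct)
    (simp_all add: partial_add, simp_all add: partial_def)

lemma partial_mult: "partial i (f * g) = partial i f * g + f * partial i g"
proof (induction f rule: poly_monomial_induct)
  case (monomial m c)
  show ?case
  proof (induction g rule: poly_monomial_induct)
    case (monomial m' c')
    let ?e = "Poly_Mapping.single i (1::nat)"
    let ?k = "Poly_Mapping.lookup m i" and ?k' = "Poly_Mapping.lookup m' i"
    \<comment> \<open>Where the subtraction of exponents truncates, the coefficient vanishes.\<close>
    have "Poly_Mapping.single (m + m' - ?e) (of_nat ?k * (c * c'))
        = Poly_Mapping.single (m - ?e + m') (of_nat ?k * (c * c'))"
    proof (cases "?k = 0")
      case False
      then have "m + m' - ?e = m - ?e + m'"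
        by (auto simp: poly_mapping_eq_iff fun_eq_iff lookup_add lookup_minus lookup_single when_def)
      then show ?thesis by simp
    qed simp
    moreover have "Poly_Mapping.single (m + m' - ?e) (of_nat ?k' * (c * c'))
        = Poly_Mapping.single (m + (m' - ?e)) (of_nat ?k' * (c * c'))"
    proof (cases "?k' = 0")
      case False
      then have "m + m' - ?e = m + (m' - ?e)"
        by (auto simp: poly_mapping_eq_iff fun_eq_iff lookup_add lookup_minus lookup_single when_def)
      then show ?thesis by simp
    qed simp
    moreover have "c * (of_nat ?k' * c') = of_nat ?k' * (c * c')"
      by (simp add: mult_ac)
    ultimately show ?case
      by (simp add: mult_single partial_single lookup_add distrib_right single_add mult.assoc)
  qed (simp add: distrib_left partial_add add_ac)
qed (simp add: distrib_right partial_add add_ac)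

section \<open>Homogeneous polynomials\<close>

lemma homogeneous_0: "homogeneous d 0"
  by (simp add: homogeneous_def)

lemma homogeneous_add: "homogeneous d f \<Longrightarrow> homogeneous d g \<Longrightarrow> homogeneous d (f + g)"
  using Poly_Mapping.keys_add[of f g] by (auto simp: homogeneous_def)

lemma homogeneous_sum: "(\<And>a. a \<in> A \<Longrightarrow> homogeneous d (f a)) \<Longrightarrow> homogeneous d (sum f A)"
  by (induction A rule: infinite_finite_induct) (auto intro: homogeneous_add homogeneous_0)

lemma homogeneous_mult:
  "homogeneous d f \<Longrightarrow> homogeneous e g \<Longrightarrow> homogeneous (d + e) (f * g)"
  using keys_mult[of f g] by (fastforce simp: homogeneous_def mon_degree_add)

lemma homogeneous_single: "mon_degree m = d \<Longrightarrow> homogeneous d (Poly_Mapping.single m c)"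
  by (simp add: homogeneous_def)

lemma homogeneous_Const: "homogeneous 0 (Const c)"
  by (simp add: Const_def homogeneous_single mon_degree_0_iff)

lemma homogeneous_Var: "homogeneous 1 (Var i)"
  by (simp add: Var_def homogeneous_single mon_degree_single)

lemma lookup_homogeneous_part:
  "Poly_Mapping.lookup (homogeneous_part d f) m =
    (if mon_degree m = d then Poly_Mapping.lookup f m else 0)"
proof -
  let ?K = "{m \<in> Poly_Mapping.keys f. mon_degree m = d}"
  have "Poly_Mapping.lookup (homogeneous_part d f) m
    = (\<Sum>m'\<in>?K. if m' = m then Poly_Mapping.lookup f m' else 0)"
    unfolding homogeneous_part_def lookup_sum
    by (rule sum.cong) (auto simp: lookup_single when_def)
  also have "\<dots> = (if m \<in> ?K then Poly_Mapping.lookup f m else 0)"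
    by simp
  finally show ?thesis
    by (auto simp: in_keys_iff)
qed

lemma homogeneous_part_add:
  "homogeneous_part d (f + g) = homogeneous_part d f + homogeneous_part d g"
  by (rule poly_mapping_eqI) (simp add: lookup_homogeneous_part lookup_add)

lemma homogeneous_part_homogeneous:
  "homogeneous e f \<Longrightarrow> homogeneous_part d f = (if e = d then f else 0)"
  by (rule poly_mapping_eqI) (auto simp: lookup_homogeneous_part homogeneous_def in_keys_iff)

lemma homogeneous_part_mult_homogeneous:
  assumes "homogeneous d g"
  shows "homogeneous_part d (h * g) = Const (Poly_Mapping.lookup h 0) * g"
proof (induction h rule: poly_monomial_induct)
  case (monomial m c)
  have "homogeneous (mon_degree m + d) (Poly_Mapping.single m c * g)"
    using assms by (intro homogeneous_mult homogeneous_single) auto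
  from homogeneous_part_homogeneous[OF this] show ?case
    by (auto simp: mon_degree_0_iff lookup_single Const_def)
qed (simp add: distrib_right homogeneous_part_add lookup_add Const_add)

text \<open>The monomials of degree \<open>d\<close> are a basis, so counting them gives the dimension.\<close>

lemma dim_graded_piece:
  "mpoly.dim (graded_piece d :: ('n::finite, 'k::field) mpoly set)
    = card {m :: 'n \<Rightarrow>\<^sub>0 nat. mon_degree m = d}"
proof -
  let ?x = "\<lambda>m :: 'n \<Rightarrow>\<^sub>0 nat. Poly_Mapping.single m (1 :: 'k)"
  let ?B = "?x ` {m. mon_degree m = d}"
  have inj: "inj ?x"
    by (rule injI) (metis lookup_single_eq lookup_single_not_eq zero_neq_one)
  have "?B \<subseteq> graded_piece d"
    by (auto simp: graded_piece_def homogeneous_single)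
  moreover have "graded_piece d \<subseteq> mpoly.span ?B"
  proof
    fix f :: "('n, 'k) mpoly"
    assume f: "f \<in> graded_piece d"
    have "f = (\<Sum>m\<in>Poly_Mapping.keys f. scale (Poly_Mapping.lookup f m) (?x m))"
      by (subst poly_eq_sum_monomials) (simp add: scale_def Const_mult_single)
    also have "\<dots> \<in> mpoly.span ?B"
      using f by (intro mpoly.span_sum mpoly.span_scale mpoly.span_base)
        (auto simp: graded_piece_def homogeneous_def)
    finally show "f \<in> mpoly.span ?B" .
  qed
  moreover have "mpoly.independent ?B"
    unfolding mpoly.independent_explicit_module
  proof (intro allI impI)
    fix t u v
    assume t: "finite t" "t \<subseteq> ?B" "(\<Sum>w\<in>t. scale (u w) w) = 0" "v \<in> t"
    then obtain m where m: "v = ?x m" by auto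
    have "0 = Poly_Mapping.lookup (\<Sum>w\<in>t. scale (u w) w) m"
      using t by simp
    also have "\<dots> = (\<Sum>w\<in>t. if w = v then u w else 0)"
      unfolding lookup_sum
    proof (rule sum.cong)
      fix w assume "w \<in> t"
      with t obtain m' where "w = ?x m'" by auto
      moreover from this have "w = v \<longleftrightarrow> m' = m"
        using injD[OF inj, of m' m] by (auto simp: m)
      ultimately show "Poly_Mapping.lookup (scale (u w) w) m = (if w = v then u w else 0)"
        by (simp add: scale_def Const_mult_single lookup_single when_def)
    qed simp
    also have "\<dots> = u v"
      using t by simp
    finally show "u v = 0" by simp
  qed
  moreover have "card ?B = card {m :: 'n \<Rightarrow>\<^sub>0 nat. mon_degree m = d}"
    using inj by (intro card_image) (auto intro: inj_on_subset)
  ultimately show ?thesis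
    by (rule mpoly.dim_unique)
qed

lemma card_quadratic_monomials_3: "card {m :: 3 \<Rightarrow>\<^sub>0 nat. mon_degree m = 2} = 6"
proof -
  define P :: "(3 \<times> 3) set" where "P = {(1, 1), (1, 2), (1, 3), (2, 2), (2, 3), (3, 3)}"
  define x :: "3 \<times> 3 \<Rightarrow> 3 \<Rightarrow>\<^sub>0 nat"
    where "x = (\<lambda>(a, b). Poly_Mapping.single a 1 + Poly_Mapping.single b 1)"
  define g :: "(3 \<Rightarrow>\<^sub>0 nat) \<Rightarrow> nat \<times> nat \<times> nat"
    where "g m = (Poly_Mapping.lookup m 1, Poly_Mapping.lookup m 2, Poly_Mapping.lookup m 3)" for m
  have "m \<in> x ` P" if "mon_degree m = 2" for m
  proof -
    from that have "mon_degree m = Suc (Suc 0)" by simp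
    then obtain a m' where m: "m = Poly_Mapping.single a 1 + m'" "mon_degree m' = Suc 0"
      by (rule mon_degree_SucE)
    from m(2) obtain b m'' where m': "m' = Poly_Mapping.single b 1 + m''" "mon_degree m'' = 0"
      by (rule mon_degree_SucE)
    have "m = x (a, b)"
      using m m' by (simp add: mon_degree_0_iff x_def)
    moreover have "x (a, b) = x (b, a)"
      by (simp add: add.commute x_def)
    moreover have "(a, b) \<in> P \<or> (b, a) \<in> P"
      using exhaust_3[of a] exhaust_3[of b] by (auto simp: P_def)
    ultimately show ?thesis
      by (metis image_eqI)
  qed
  moreover have "mon_degree (x p) = 2" for p
    by (cases p) (simp add: x_def mon_degree_add mon_degree_single)
  ultimately have monomials: "{m. mon_degree m = 2} = x ` P"
    by blast
  have P: "finite P" "card P = 6"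
    by (simp_all add: P_def)
  have "g ` x ` P = {(2, 0, 0), (1, 1, 0), (1, 0, 1), (0, 2, 0), (0, 1, 1), (0, 0, 2)}"
    by (simp add: P_def x_def g_def lookup_add lookup_single when_def numeral_2_eq_2)
  then have "card (g ` x ` P) = 6"
    by simp
  then have "6 \<le> card (x ` P)"
    using card_image_le[of "x ` P" g] P by simp
  moreover have "card (x ` P) \<le> 6"
    using card_image_le[of P x] P by simp
  ultimately show ?thesis
    by (simp add: monomials)
qed

lemma partial_homogeneous:
  assumes "homogeneous (Suc e) f"
  shows "homogeneous e (partial i f)"
  unfolding partial_def
proof (rule homogeneous_sum)
  fix m
  assume "m \<in> Poly_Mapping.keys f"
  then have deg: "mon_degree m = Suc e"
    using assms by (simp add: homogeneous_def)
  show "homogeneous e (Poly_Mapping.single (m - Poly_Mapping.single i 1)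
    (of_nat (Poly_Mapping.lookup m i) * Poly_Mapping.lookup f m))"
  proof (cases "Poly_Mapping.lookup m i = 0")
    case False
    then have "m = Poly_Mapping.single i 1 + (m - Poly_Mapping.single i 1)"
      by (auto simp: poly_mapping_eq_iff fun_eq_iff lookup_add lookup_minus lookup_single when_def)
    then have "mon_degree m = 1 + mon_degree (m - Poly_Mapping.single i 1)"
      by (metis mon_degree_add mon_degree_single)
    with deg show ?thesis
      by (intro homogeneous_single) simp
  qed (simp add: homogeneous_0)
qed

lemma single_1_eq_iff: "Poly_Mapping.single a (1::nat) = Poly_Mapping.single b 1 \<longleftrightarrow> a = b"
  by (metis lookup_single_eq lookup_single_not_eq zero_neq_one)

lemma linear_form_coefficients:
  fixes l :: "('n::finite, 'k::comm_semiring_1) mpoly"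
  assumes "homogeneous 1 l"
  obtains c where "l = (\<Sum>a\<in>UNIV. Const (c a) * Var a)"
proof
  let ?c = "\<lambda>a. Poly_Mapping.lookup l (Poly_Mapping.single a 1)"
  show "l = (\<Sum>a\<in>UNIV. Const (?c a) * Var a)"
  proof (rule poly_mapping_eqI)
    fix m
    have sum: "Poly_Mapping.lookup (\<Sum>a\<in>UNIV. Const (?c a) * Var a) m
      = (\<Sum>a\<in>UNIV. if Poly_Mapping.single a 1 = m then ?c a else 0)"
      by (simp add: lookup_sum Var_def Const_mult_single lookup_single when_def del: One_nat_def)
    show "Poly_Mapping.lookup l m = Poly_Mapping.lookup (\<Sum>a\<in>UNIV. Const (?c a) * Var a) m"
    proof (cases "mon_degree m = 1")
      case True
      then have "mon_degree m = Suc 0" by simp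
      then obtain b m' where "m = Poly_Mapping.single b 1 + m'" "mon_degree m' = 0"
        by (rule mon_degree_SucE)
      then have m: "m = Poly_Mapping.single b 1"
        by (simp add: mon_degree_0_iff)
      then have "Poly_Mapping.single a 1 = m \<longleftrightarrow> a = b" for a
        using single_1_eq_iff by metis
      then show ?thesis
        unfolding sum by (simp add: m)
    next
      case False
      then have "Poly_Mapping.lookup l m = 0"
        using assms by (auto simp: homogeneous_def in_keys_iff)
      moreover have "Poly_Mapping.single a 1 \<noteq> m" for a
        using False by (auto simp: mon_degree_single)
      ultimately show ?thesis
        unfolding sum by simp
    qed
  qed
qed

lemma homogeneous_linear_form: "homogeneous 1 (\<Sum>a\<in>UNIV. Const (c a) * Var a)"
  using homogeneous_mult[OF homogeneous_Const homogeneous_Var] by (intro homogeneous_sum) simp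

section \<open>Symmetric trilinear forms and ternary cubics\<close>

text \<open>
  The ring of scalars is left open, so that the same form can be applied to vectors over the
  field and to vectors of polynomials, such as the vector of the variables.
\<close>

definition trilinear ::
  "('n::finite \<Rightarrow> 'n \<Rightarrow> 'n \<Rightarrow> 'b::comm_semiring_1) \<Rightarrow> ('n \<Rightarrow> 'b) \<Rightarrow> ('n \<Rightarrow> 'b) \<Rightarrow> ('n \<Rightarrow> 'b) \<Rightarrow> 'b"
  where "trilinear C u v w = (\<Sum>a\<in>UNIV. \<Sum>b\<in>UNIV. \<Sum>c\<in>UNIV. C a b c * u a * v b * w c)"

definition symmetric_tensor :: "('n \<Rightarrow> 'n \<Rightarrow> 'n \<Rightarrow> 'b) \<Rightarrow> bool"
  where "symmetric_tensor C \<longleftrightarrow> (\<forall>a b c. C a b c = C b a c \<and> C a b c = C a c b)"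

abbreviation Const_tensor ::
  "('n \<Rightarrow> 'n \<Rightarrow> 'n \<Rightarrow> 'k::zero) \<Rightarrow> 'n \<Rightarrow> 'n \<Rightarrow> 'n \<Rightarrow> ('n::finite, 'k) mpoly"
  where "Const_tensor C \<equiv> (\<lambda>a b c. Const (C a b c))"

definition cubic_form :: "('n::finite \<Rightarrow> 'n \<Rightarrow> 'n \<Rightarrow> 'k::comm_semiring_1) \<Rightarrow> ('n, 'k) mpoly"
  where "cubic_form C = trilinear (Const_tensor C) Var Var Var"

lemma trilinear_add_1:
    "trilinear C (\<lambda>a. u a + u' a) v w = trilinear C u v w + trilinear C u' v w"
  and trilinear_add_2:
    "trilinear C u (\<lambda>a. v a + v' a) w = trilinear C u v w + trilinear C u v' w"
  and trilinear_add_3: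
    "trilinear C u v (\<lambda>a. w a + w' a) = trilinear C u v w + trilinear C u v w'"
  by (simp_all add: trilinear_def algebra_simps sum.distrib)

lemma trilinear_scale_1: "trilinear C (\<lambda>a. k * u a) v w = k * trilinear C u v w"
  and trilinear_scale_2: "trilinear C u (\<lambda>a. k * v a) w = k * trilinear C u v w"
  by (simp_all add: trilinear_def sum_distrib_left mult_ac)

lemma trilinear_tensor_add:
    "trilinear (\<lambda>a b c. C a b c + D a b c) u v w = trilinear C u v w + trilinear D u v w"
  and trilinear_tensor_scale:
    "trilinear (\<lambda>a b c. k * C a b c) u v w = k * trilinear C u v w"
  by (simp_all add: trilinear_def algebra_simps sum.distrib sum_distrib_left)

lemma trilinear_permute_12: "trilinear (\<lambda>a b c. C b a c) u v w = trilinear C v u w"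
  unfolding trilinear_def by (subst sum.swap) (simp add: mult_ac)

lemma trilinear_permute_23: "trilinear (\<lambda>a b c. C a c b) u v w = trilinear C u w v"
  unfolding trilinear_def
  by (rule sum.cong[OF refl], subst sum.swap) (simp add: mult_ac)

lemma trilinear_swap_12: "symmetric_tensor C \<Longrightarrow> trilinear C u v w = trilinear C v u w"
proof -
  assume "symmetric_tensor C"
  then have "(\<lambda>a b c. C b a c) = C"
    by (intro ext) (metis symmetric_tensor_def)
  then show ?thesis
    using trilinear_permute_12[of C u v w] by simp
qed

lemma trilinear_swap_23: "symmetric_tensor C \<Longrightarrow> trilinear C u v w = trilinear C u w v"
proof -
  assume "symmetric_tensor C"
  then have "(\<lambda>a b c. C a c b) = C"
    by (intro ext) (metis symmetric_tensor_def)
  then show ?thesis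
    using trilinear_permute_23[of C u v w] by simp
qed

lemma trilinear_contract:
  "trilinear C u v w = (\<Sum>b\<in>UNIV. \<Sum>c\<in>UNIV. (\<Sum>a\<in>UNIV. u a * C a b c) * v b * w c)"
proof -
  have "(\<Sum>b\<in>UNIV. \<Sum>c\<in>UNIV. (\<Sum>a\<in>UNIV. u a * C a b c) * v b * w c)
    = (\<Sum>b\<in>UNIV. \<Sum>c\<in>UNIV. \<Sum>a\<in>UNIV. C a b c * u a * v b * w c)"
    by (simp add: sum_distrib_left sum_distrib_right mult_ac)
  also have "\<dots> = (\<Sum>b\<in>UNIV. \<Sum>a\<in>UNIV. \<Sum>c\<in>UNIV. C a b c * u a * v b * w c)"
    by (rule sum.cong[OF refl], rule sum.swap)
  also have "\<dots> = trilinear C u v w"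
    unfolding trilinear_def by (rule sum.swap)
  finally show ?thesis ..
qed

lemma trilinear_basis_expansion:
  "trilinear C u v w = (\<Sum>i\<in>UNIV. u i * trilinear C (\<lambda>a. if a = i then 1 else 0) v w)"
proof -
  have "trilinear C (\<lambda>a. if a = i then 1 else 0) v w
    = (\<Sum>b\<in>UNIV. \<Sum>c\<in>UNIV. C i b c * v b * w c)" for i
    by (simp add: trilinear_contract if_distrib[of "\<lambda>x. x * _"] cong: if_cong)
  then show ?thesis
    by (simp add: trilinear_def sum_distrib_left mult_ac)
qed

lemma trilinear_hom:
  assumes "h 0 = 0" "\<And>x y. h (x + y) = h x + h y" "\<And>x y. h (x * y) = h x * h y"
  shows "h (trilinear C u v w) =
    trilinear (\<lambda>a b c. h (C a b c)) (\<lambda>a. h (u a)) (\<lambda>a. h (v a)) (\<lambda>a. h (w a))"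
proof -
  have "h (sum g A) = (\<Sum>a\<in>A. h (g a))" for g and A :: "'c set"
    by (induction A rule: infinite_finite_induct) (simp_all add: assms)
  then show ?thesis
    by (simp add: trilinear_def assms(3))
qed

lemma eval_at_trilinear:
  "eval_at (trilinear (Const_tensor C) u v w) p =
    trilinear C (\<lambda>a. eval_at (u a) p) (\<lambda>a. eval_at (v a) p) (\<lambda>a. eval_at (w a) p)"
  by (subst trilinear_hom[of "\<lambda>f. eval_at f p"])
    (simp_all add: eval_at_0 eval_at_add eval_at_mult eval_at_Const)

lemma eval_at_cubic_form: "eval_at (cubic_form C) p = trilinear C (($) p) (($) p) (($) p)"
  by (simp add: cubic_form_def eval_at_trilinear eval_at_Var)

lemma homogeneous_trilinear:
  assumes "\<And>a. homogeneous d (u a)" "\<And>a. homogeneous e (v a)" "\<And>a. homogeneous k (w a)"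
  shows "homogeneous (d + e + k) (trilinear (Const_tensor C) u v w)"
  unfolding trilinear_def
proof (intro homogeneous_sum)
  fix a b c
  have "homogeneous (0 + d + e + k) (Const (C a b c) * u a * v b * w c)"
    by (intro homogeneous_mult homogeneous_Const assms)
  then show "homogeneous (d + e + k) (Const (C a b c) * u a * v b * w c)"
    by simp
qed

lemma cubic_form_add: "cubic_form (\<lambda>a b c. C a b c + D a b c) = cubic_form C + cubic_form D"
  by (simp add: cubic_form_def Const_add trilinear_tensor_add)

lemma cubic_monomial_is_cubic_form:
  assumes "mon_degree m = 3"
  shows "\<exists>C. Poly_Mapping.single m r = cubic_form C"
proof -
  from assms have "mon_degree m = Suc (Suc (Suc 0))" by simp
  then obtain i m1 where m: "m = Poly_Mapping.single i 1 + m1" "mon_degree m1 = Suc (Suc 0)"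
    by (rule mon_degree_SucE)
  from m(2) obtain j m2 where m1: "m1 = Poly_Mapping.single j 1 + m2" "mon_degree m2 = Suc 0"
    by (rule mon_degree_SucE)
  from m1(2) obtain k m3 where m2: "m2 = Poly_Mapping.single k 1 + m3" "mon_degree m3 = 0"
    by (rule mon_degree_SucE)
  define C where "C a b c = (if a = i then if b = j then if c = k then r else 0 else 0 else 0)" for a b c
  have "cubic_form C = (\<Sum>a\<in>UNIV. \<Sum>b\<in>UNIV. \<Sum>c\<in>UNIV. if c = k
    then if b = j then if a = i then Const r * Var i * Var j * Var k else 0 else 0 else 0)"
    unfolding cubic_form_def trilinear_def
    by (intro sum.cong refl) (simp add: C_def Const_0)
  also have "\<dots> = Const r * Var i * Var j * Var k"
    by simp
  also have "\<dots> = Poly_Mapping.single m r"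
    using m m1 m2 by (simp add: mon_degree_0_iff Const_mult_single Var_def mult_single add.assoc)
  finally show ?thesis
    by metis
qed

lemma homogeneous_3_is_cubic_form:
  assumes "homogeneous 3 f"
  shows "\<exists>C. f = cubic_form C"
proof -
  have "\<exists>C. (\<Sum>m\<in>A. Poly_Mapping.single m (r m)) = cubic_form C"
    if "finite A" "\<forall>m\<in>A. mon_degree m = 3" for A r
    using that
  proof (induction A rule: finite_induct)
    case empty
    have "0 = cubic_form (\<lambda>_ _ _. 0)"
      by (simp add: cubic_form_def trilinear_def Const_0)
    then show ?case by auto
  next
    case (insert m A)
    then obtain C D where
      "Poly_Mapping.single m (r m) = cubic_form C"
      "(\<Sum>m\<in>A. Poly_Mapping.single m (r m)) = cubic_form D"
      using cubic_monomial_is_cubic_form[of m "r m"] by auto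
    with insert.hyps have "(\<Sum>m\<in>insert m A. Poly_Mapping.single m (r m))
        = cubic_form (\<lambda>a b c. C a b c + D a b c)"
      by (simp add: cubic_form_add)
    then show ?case
      by blast
  qed
  from this[of "Poly_Mapping.keys f" "Poly_Mapping.lookup f"] show ?thesis
    using assms by (simp add: homogeneous_def flip: poly_eq_sum_monomials)
qed

text \<open>
  Averaging over the six permutations of the indices makes the tensor symmetric without changing
  the cubic, since the variables commute.
\<close>

lemma homogeneous_3_is_symmetric_cubic_form:
  fixes f :: "('n::finite, 'k::field_char_0) mpoly"
  assumes "homogeneous 3 f"
  obtains C where "symmetric_tensor C" "f = cubic_form C"
proof -
  from homogeneous_3_is_cubic_form[OF assms] obtain C where f: "f = cubic_form C" ..
  define D where
    "D a b c = 1 / 6 * (C a b c + C a c b + C b a c + C b c a + C c a b + C c b a)" for a b c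
  have "symmetric_tensor D"
    by (simp add: symmetric_tensor_def D_def add_ac)
  moreover have "cubic_form D = Const (1 / 6) * (f + f + f + f + f + f)"
  proof -
    note perms = trilinear_permute_23[of "Const_tensor C"]
      trilinear_permute_12[of "Const_tensor C"]
      trilinear_permute_12[of "\<lambda>a b c. Const (C a c b)"]
      trilinear_permute_23[of "\<lambda>a b c. Const (C b a c)"]
      trilinear_permute_12[of "\<lambda>a b c. Const (C c a b)"]
    show ?thesis
      unfolding f cubic_form_def D_def Const_mult Const_add trilinear_tensor_scale
        trilinear_tensor_add perms ..
  qed
  moreover have "\<dots> = f"
  proof -
    have "f + f + f + f + f + f = Const 6 * f"
      by (simp add: Const_numeral)
    then have "Const (1 / 6) * (f + f + f + f + f + f) = Const (1 / 6 * 6) * f"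
      by (simp only: Const_mult mult.assoc)
    then show ?thesis
      by (simp add: Const_1)
  qed
  ultimately show ?thesis
    using that by simp
qed

section \<open>Singular points and nodes in terms of the trilinear form\<close>

definition directional :: "('n::finite \<Rightarrow> 'k::comm_semiring_1) \<Rightarrow> ('n, 'k) mpoly \<Rightarrow> ('n, 'k) mpoly"
  where "directional v f = (\<Sum>i\<in>UNIV. Const (v i) * partial i f)"

lemma partial_cubic_form:
  assumes "symmetric_tensor C"
  shows "partial i (cubic_form C) =
    Const 3 * trilinear (Const_tensor C) (\<lambda>a. if a = i then 1 else 0) Var Var"
proof -
  let ?T = "trilinear (Const_tensor C)" and ?d = "\<lambda>a. if a = i then 1 else 0"
  have sym: "symmetric_tensor (Const_tensor C)"
    using assms unfolding symmetric_tensor_def by metis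
  have "partial i (cubic_form C) = ?T ?d Var Var + ?T Var ?d Var + ?T Var Var ?d"
    by (simp add: cubic_form_def trilinear_def partial_sum partial_mult partial_Const partial_Var
        distrib_right distrib_left sum.distrib mult.assoc add.assoc)
  also have "?T Var ?d Var = ?T ?d Var Var"
    by (rule trilinear_swap_12[OF sym])
  also have "?T Var Var ?d = ?T ?d Var Var"
    using trilinear_swap_23[OF sym, of Var Var ?d] trilinear_swap_12[OF sym, of Var ?d Var] by simp
  finally show ?thesis
    by (simp only: Const_3_mult)
qed

lemma directional_cubic_form:
  assumes "symmetric_tensor C"
  shows "directional v (cubic_form C) =
    Const 3 * trilinear (Const_tensor C) (\<lambda>a. Const (v a)) Var Var"
  by (subst trilinear_basis_expansion)
    (simp add: directional_def partial_cubic_form[OF assms] sum_distrib_left mult_ac)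

lemma eval_at_directional_cubic_form:
  assumes "symmetric_tensor C"
  shows "eval_at (directional v (cubic_form C)) p = 3 * trilinear C v (($) p) (($) p)"
  by (simp add: directional_cubic_form[OF assms] eval_at_mult eval_at_Const eval_at_trilinear
      eval_at_Var)

lemma singular_point_cubic_form_iff:
  fixes C :: "'n::finite \<Rightarrow> 'n \<Rightarrow> 'n \<Rightarrow> 'k::field_char_0"
  assumes C: "symmetric_tensor C"
  shows "singular_point (cubic_form C) p \<longleftrightarrow>
    p \<noteq> 0 \<and> (\<forall>w. trilinear C (($) p) (($) p) w = 0)"
proof -
  let ?F = "trilinear C"
  have "eval_at (partial i (cubic_form C)) p =
      3 * ?F (\<lambda>a. if a = i then 1 else 0) (($) p) (($) p)" for i
    by (simp add: partial_cubic_form[OF C] eval_at_mult eval_at_Const eval_at_trilinear eval_at_Var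
        if_distrib[of "\<lambda>f. eval_at f p"] eval_at_0 eval_at_Const[of 1, unfolded Const_1] cong: if_cong)
  then have "(\<forall>i. eval_at (partial i (cubic_form C)) p = 0) \<longleftrightarrow>
      (\<forall>i. ?F (\<lambda>a. if a = i then 1 else 0) (($) p) (($) p) = 0)"
    by simp
  also have "(\<forall>i. ?F (\<lambda>a. if a = i then 1 else 0) (($) p) (($) p) = 0) \<longleftrightarrow>
      (\<forall>w. ?F w (($) p) (($) p) = 0)"
  proof
    assume basis: "\<forall>i. ?F (\<lambda>a. if a = i then 1 else 0) (($) p) (($) p) = 0"
    show "\<forall>w. ?F w (($) p) (($) p) = 0"
      by (subst trilinear_basis_expansion) (simp add: basis)
  qed blast
  also have "\<dots> \<longleftrightarrow> (\<forall>w. ?F (($) p) (($) p) w = 0)"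
    by (metis trilinear_swap_12[OF C] trilinear_swap_23[OF C])
  finally show ?thesis
    unfolding singular_point_def eval_at_cubic_form by blast
qed

text \<open>
  In the chart \<open>x\<^sub>i = 1\<close> the cubic becomes \<open>F(x + q, x + q, x + q)\<close> with \<open>x\<^sub>i\<close> replaced by \<open>0\<close> and
  \<open>q = p / p\<^sub>i\<close>; by trilinearity and symmetry its part of degree two is \<open>3 F(q, x, x)\<close>.
\<close>

lemma homogeneous_part_2_local_equation:
  fixes C :: "'n::finite \<Rightarrow> 'n \<Rightarrow> 'n \<Rightarrow> 'k::field"
  assumes C: "symmetric_tensor C" and "p $ i \<noteq> 0"
  shows "homogeneous_part 2 (local_equation i p (cubic_form C)) =
    Const 3 * trilinear (Const_tensor C) (\<lambda>j. Const (p $ j / p $ i))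
      (\<lambda>j. if j = i then 0 else Var j) (\<lambda>j. if j = i then 0 else Var j)"
proof -
  let ?T = "trilinear (Const_tensor C)"
  define P :: "'n \<Rightarrow> ('n, 'k) mpoly" where "P = (\<lambda>j. Const (p $ j / p $ i))"
  define X :: "'n \<Rightarrow> ('n, 'k) mpoly" where "X = (\<lambda>j. if j = i then 0 else Var j)"
  have sym: "symmetric_tensor (Const_tensor C)"
    using C unfolding symmetric_tensor_def by metis
  have X: "homogeneous 1 (X a)" for a
    by (simp add: X_def homogeneous_0 homogeneous_Var del: One_nat_def)
  have P: "homogeneous 0 (P a)" for a
    by (simp add: P_def homogeneous_Const)
  have s: "(\<lambda>j. if j = i then 1 else Var j + Const (p $ j / p $ i)) = (\<lambda>j. X j + P j)"
    using assms by (auto simp: X_def P_def Const_1)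
  have "local_equation i p (cubic_form C) = ?T (\<lambda>j. X j + P j) (\<lambda>j. X j + P j) (\<lambda>j. X j + P j)"
    unfolding local_equation_def s cubic_form_def
    by (subst trilinear_hom[of "insertion Const _"])
      (simp_all add: insertion_add insertion_mult insertion_Const insertion_Var
        Const_0 Const_1 Const_add Const_mult, simp add: insertion_def)
  also have "\<dots> = ?T X X X + ?T X X P + ?T X P X + ?T P X X
      + (?T X P P + ?T P X P + ?T P P X) + ?T P P P"
    by (simp add: trilinear_add_1 trilinear_add_2 trilinear_add_3 add_ac)
  finally have "homogeneous_part 2 (local_equation i p (cubic_form C)) =
      ?T X X P + ?T X P X + ?T P X X"
    using
      homogeneous_part_homogeneous[OF homogeneous_trilinear[OF X X X], of 2 C]
      homogeneous_part_homogeneous[OF homogeneous_trilinear[OF X X P], of 2 C]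
      homogeneous_part_homogeneous[OF homogeneous_trilinear[OF X P X], of 2 C]
      homogeneous_part_homogeneous[OF homogeneous_trilinear[OF P X X], of 2 C]
      homogeneous_part_homogeneous[OF homogeneous_trilinear[OF X P P], of 2 C]
      homogeneous_part_homogeneous[OF homogeneous_trilinear[OF P X P], of 2 C]
      homogeneous_part_homogeneous[OF homogeneous_trilinear[OF P P X], of 2 C]
      homogeneous_part_homogeneous[OF homogeneous_trilinear[OF P P P], of 2 C]
    by (simp add: homogeneous_part_add)
  also have "?T X X P = ?T P X X"
    using trilinear_swap_23[OF sym, of X X P] trilinear_swap_12[OF sym, of X P X] by simp
  also have "?T X P X = ?T P X X"
    by (rule trilinear_swap_12[OF sym])
  finally show ?thesis
    by (simp only: Const_3_mult P_def X_def)
qed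

lemma polar_form_local_equation:
  fixes C :: "'n::finite \<Rightarrow> 'n \<Rightarrow> 'n \<Rightarrow> 'k::field"
  assumes C: "symmetric_tensor C" and "p $ i \<noteq> 0" "u $ i = 0" "v $ i = 0"
  shows "polar_form (homogeneous_part 2 (local_equation i p (cubic_form C))) u v =
    6 / p $ i * trilinear C (($) p) (($) u) (($) v)"
proof -
  let ?F = "trilinear C"
  have eval: "eval_at (homogeneous_part 2 (local_equation i p (cubic_form C))) w =
      3 / p $ i * ?F (($) p) (($) w) (($) w)" if "w $ i = 0" for w
  proof -
    have "(\<lambda>a. eval_at (if a = i then 0 else Var a) w) = ($) w"
      using that by (auto simp: eval_at_0 eval_at_Var)
    moreover have "(\<lambda>j. p $ j / p $ i) = (\<lambda>j. 1 / p $ i * p $ j)"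
      by simp
    ultimately show ?thesis
      by (simp only: homogeneous_part_2_local_equation[OF C assms(2)] eval_at_mult eval_at_Const
          eval_at_trilinear trilinear_scale_1) simp
  qed
  have "(($) (u + v)) = (\<lambda>a. u $ a + v $ a)"
    by auto
  then have "?F (($) p) (($) (u + v)) (($) (u + v)) =
      ?F (($) p) (($) u) (($) u) + ?F (($) p) (($) v) (($) v) + 2 * ?F (($) p) (($) u) (($) v)"
    using trilinear_swap_23[OF C, of "($) p" "($) u" "($) v"]
    by (simp add: trilinear_add_2 trilinear_add_3)
  then show ?thesis
    using assms by (simp add: polar_form_def eval field_simps)
qed

text \<open>
  The bilinear form \<open>F(p, \<cdot>, \<cdot>)\<close> always has \<open>p\<close> in its kernel at a singular point \<open>p\<close>, and the
  hyperplane \<open>u\<^sub>i = 0\<close> of a chart is a complement of the line spanned by \<open>p\<close>. So the quadratic part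
  of the local equation is the form induced on the quotient by that line.
\<close>

lemma node_cubic_form_iff:
  fixes C :: "'n::finite \<Rightarrow> 'n \<Rightarrow> 'n \<Rightarrow> 'k::field_char_0"
  assumes C: "symmetric_tensor C" and p: "singular_point (cubic_form C) p"
  shows "node (cubic_form C) p \<longleftrightarrow>
    (\<forall>u. (\<forall>w. trilinear C (($) p) u w = 0) \<longrightarrow> (\<exists>c. u = (\<lambda>a. c * p $ a)))"
proof -
  let ?F = "trilinear C"
  from p have "p \<noteq> 0" and pp: "?F (($) p) (($) p) w = 0" for w
    by (simp_all add: singular_point_cubic_form_iff[OF C])
  have nondeg: "nondegenerate_off i (homogeneous_part 2 (local_equation i p (cubic_form C))) \<longleftrightarrow>
      (\<forall>u. u $ i = 0 \<and> (\<forall>w. ?F (($) p) (($) u) w = 0) \<longrightarrow> u = 0)" if i: "p $ i \<noteq> 0" for i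
  proof -
    have "(\<forall>v. v $ i = 0 \<longrightarrow>
        polar_form (homogeneous_part 2 (local_equation i p (cubic_form C))) u v = 0)
      \<longleftrightarrow> (\<forall>w. ?F (($) p) (($) u) w = 0)" (is "?L \<longleftrightarrow> ?R") if u: "u $ i = 0" for u
    proof
      assume L: ?L
      show ?R
      proof
        fix w
        define c where "c = w i / p $ i"
        define v where "v = (\<chi> a. w a - c * p $ a)"
        have "v $ i = 0"
          using i by (simp add: v_def c_def)
        with L u i have v: "?F (($) p) (($) u) (($) v) = 0"
          by (simp add: polar_form_local_equation[OF C])
        have "w = (\<lambda>a. v $ a + c * p $ a)"
          by (simp add: v_def)
        then have "?F (($) p) (($) u) w = ?F (($) p) (($) u) (($) v)
            + ?F (($) p) (($) u) (\<lambda>a. c * p $ a)"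
          by (metis trilinear_add_3)
        also have "?F (($) p) (($) u) (\<lambda>a. c * p $ a) = c * ?F (($) p) (($) p) (($) u)"
          by (subst trilinear_swap_23[OF C]) (rule trilinear_scale_2)
        finally show "?F (($) p) (($) u) w = 0"
          using v pp by simp
      qed
    next
      assume ?R
      then show ?L
        using u i by (simp add: polar_form_local_equation[OF C])
    qed
    then show ?thesis
      unfolding nondegenerate_off_def by blast
  qed
  show ?thesis
  proof
    assume "node (cubic_form C) p"
    then obtain i where i: "p $ i \<noteq> 0"
      and nd: "\<And>u. u $ i = 0 \<Longrightarrow> (\<forall>w. ?F (($) p) (($) u) w = 0) \<Longrightarrow> u = 0"
      using nondeg by (auto simp: node_def)
    show "\<forall>u. (\<forall>w. ?F (($) p) u w = 0) \<longrightarrow> (\<exists>c. u = (\<lambda>a. c * p $ a))"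
    proof (intro allI impI)
      fix u
      assume u: "\<forall>w. ?F (($) p) u w = 0"
      define c where "c = u i / p $ i"
      define v where "v = (\<chi> a. u a + (- c) * p $ a)"
      have "?F (($) p) (($) v) w = 0" for w
      proof -
        have "(($) v) = (\<lambda>a. u a + (- c) * p $ a)"
          by (auto simp: v_def)
        then show ?thesis
          using u pp by (simp only: trilinear_add_2 trilinear_scale_2) simp
      qed
      moreover have "v $ i = 0"
        using i by (simp add: v_def c_def)
      ultimately have "v = 0"
        by (intro nd) auto
      then have "u a = c * p $ a" for a
        by (simp add: v_def vec_eq_iff)
      then show "\<exists>c. u = (\<lambda>a. c * p $ a)"
        by blast
    qed
  next
    assume R: "\<forall>u. (\<forall>w. ?F (($) p) u w = 0) \<longrightarrow> (\<exists>c. u = (\<lambda>a. c * p $ a))"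
    from \<open>p \<noteq> 0\<close> obtain i where i: "p $ i \<noteq> 0"
      by (auto simp: vec_eq_iff)
    have "u = 0" if "u $ i = 0" "\<forall>w. ?F (($) p) (($) u) w = 0" for u
    proof -
      from R that obtain c where c: "($) u = (\<lambda>a. c * p $ a)"
        by blast
      with that i have "c = 0"
        by (metis mult_eq_0_iff)
      with c show ?thesis
        by (simp add: vec_eq_iff fun_eq_iff)
    qed
    with i p show "node (cubic_form C) p"
      using nondeg[OF i] by (auto simp: node_def)
  qed
qed

section \<open>The gradient ideal and Veronese avoidance\<close>

lemma (in vector_space) range_combination_eq_span:
  fixes g :: "'n::finite \<Rightarrow> 'b"
  shows "range (\<lambda>v. \<Sum>i\<in>UNIV. scale (v i) (g i)) = span (range g)"
proof
  show "range (\<lambda>v. \<Sum>i\<in>UNIV. scale (v i) (g i)) \<subseteq> span (range g)"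
    by (intro image_subsetI span_sum span_scale span_base rangeI)
  have "range g \<subseteq> range (\<lambda>v. \<Sum>i\<in>UNIV. scale (v i) (g i))"
  proof (rule image_subsetI)
    fix j
    have "g j = (\<Sum>i\<in>UNIV. scale (if i = j then 1 else 0) (g i))"
      by (simp add: if_distrib[of "\<lambda>c. scale c _"] cong: if_cong)
    then show "g j \<in> range (\<lambda>v. \<Sum>i\<in>UNIV. scale (v i) (g i))"
      by (rule image_eqI[of _ _ "\<lambda>i. if i = j then 1 else 0"]) simp
  qed
  moreover have "subspace (range (\<lambda>v. \<Sum>i\<in>UNIV. scale (v i) (g i)))"
  proof (rule subspaceI)
    show "0 \<in> range (\<lambda>v. \<Sum>i\<in>UNIV. scale (v i) (g i))"
      by (rule image_eqI[of _ _ "\<lambda>_. 0"]) auto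
  next
    fix x y
    assume "x \<in> range (\<lambda>v. \<Sum>i\<in>UNIV. scale (v i) (g i))" "y \<in> range (\<lambda>v. \<Sum>i\<in>UNIV. scale (v i) (g i))"
    then obtain v w where "x = (\<Sum>i\<in>UNIV. scale (v i) (g i))" "y = (\<Sum>i\<in>UNIV. scale (w i) (g i))"
      by blast
    then show "x + y \<in> range (\<lambda>v. \<Sum>i\<in>UNIV. scale (v i) (g i))"
      by (intro image_eqI[of _ _ "\<lambda>i. v i + w i"]) (auto simp: scale_left_distrib sum.distrib)
  next
    fix c x
    assume "x \<in> range (\<lambda>v. \<Sum>i\<in>UNIV. scale (v i) (g i))"
    then obtain v where "x = (\<Sum>i\<in>UNIV. scale (v i) (g i))"
      by blast
    then show "scale c x \<in> range (\<lambda>v. \<Sum>i\<in>UNIV. scale (v i) (g i))"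
      by (intro image_eqI[of _ _ "\<lambda>i. c * v i"]) (auto simp: scale_sum_right)
  qed
  ultimately show "span (range g) \<subseteq> range (\<lambda>v. \<Sum>i\<in>UNIV. scale (v i) (g i))"
    by (rule span_minimal)
qed

lemma (in vector_space) dim_range_combination_eq_card_iff:
  fixes g :: "'n::finite \<Rightarrow> 'b"
  shows "dim (range (\<lambda>v. \<Sum>i\<in>UNIV. scale (v i) (g i))) = CARD('n) \<longleftrightarrow>
    (\<forall>v. (\<Sum>i\<in>UNIV. scale (v i) (g i)) = 0 \<longrightarrow> v = (\<lambda>_. 0))"
proof
  assume free: "\<forall>v. (\<Sum>i\<in>UNIV. scale (v i) (g i)) = 0 \<longrightarrow> v = (\<lambda>_. 0)"
  have inj: "inj g"
  proof (rule injI, rule ccontr)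
    fix i j
    assume ij: "g i = g j" "i \<noteq> j"
    let ?v = "\<lambda>k. (if k = i then 1 else 0) - (if k = j then 1 else 0) :: 'a"
    have "(\<Sum>k\<in>UNIV. scale (?v k) (g k)) = g i - g j"
      by (simp add: scale_left_diff_distrib sum_subtractf if_distrib[of "\<lambda>c. scale c _"] cong: if_cong)
    with ij have "(\<Sum>k\<in>UNIV. scale (?v k) (g k)) = 0"
      by simp
    from free[rule_format, OF this] have "?v = (\<lambda>_. 0)" .
    from fun_cong[OF this, of i] ij show False
      by simp
  qed
  have "independent (range g)"
  proof
    assume "dependent (range g)"
    then obtain c v where v: "v \<in> range g" "c v \<noteq> 0" and "(\<Sum>v\<in>range g. scale (c v) v) = 0"
      by (auto simp: dependent_finite)
    then have "(\<Sum>i\<in>UNIV. scale (c (g i)) (g i)) = 0"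
      by (simp add: sum.reindex[OF inj])
    from free[rule_format, OF this] have "(\<lambda>i. c (g i)) = (\<lambda>_. 0)" .
    with v show False
      by (auto dest: fun_cong)
  qed
  then show "dim (range (\<lambda>v. \<Sum>i\<in>UNIV. scale (v i) (g i))) = CARD('n)"
    by (simp add: range_combination_eq_span dim_eq_card_independent card_image[OF inj])
next
  assume dim: "dim (range (\<lambda>v. \<Sum>i\<in>UNIV. scale (v i) (g i))) = CARD('n)"
  show "\<forall>v. (\<Sum>i\<in>UNIV. scale (v i) (g i)) = 0 \<longrightarrow> v = (\<lambda>_. 0)"
  proof (intro allI impI, rule ccontr)
    fix v
    assume v: "(\<Sum>i\<in>UNIV. scale (v i) (g i)) = 0" "v \<noteq> (\<lambda>_. 0)"
    then obtain i where i: "v i \<noteq> 0"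
      by auto
    let ?S = "g ` (UNIV - {i})"
    have "scale (v i) (g i) = - (\<Sum>j\<in>UNIV - {i}. scale (v j) (g j))"
      using v(1) by (simp add: sum.remove[of UNIV i] eq_neg_iff_add_eq_0)
    also have "\<dots> \<in> span ?S"
      by (intro span_neg span_sum span_scale span_base) auto
    finally have "scale (1 / v i) (scale (v i) (g i)) \<in> span ?S"
      by (rule span_scale)
    with i have "g i \<in> span ?S"
      by simp
    then have "range g \<subseteq> span ?S"
      by (auto intro: span_base)
    then have "dim (range g) \<le> card ?S"
      by (rule dim_le_card) simp
    also have "\<dots> \<le> card (UNIV - {i})"
      by (rule card_image_le) simp
    also have "\<dots> < CARD('n)"
      by (rule psubset_card_mono) auto
    finally show False
      using dim by (simp add: range_combination_eq_span)
  qed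
qed

text \<open>
  Since the partial derivatives have the lowest degree occurring in the ideal that they generate, only
  the constant terms of the coefficients of a combination matter in that degree.
\<close>

lemma gradient_ideal_lowest_piece:
  fixes f :: "('n::finite, 'k::field) mpoly"
  assumes "homogeneous (Suc e) f"
  shows "gradient_ideal f \<inter> graded_piece e = range (\<lambda>v. directional v f)"
proof -
  interpret ideal: module "(*) :: ('n, 'k) mpoly \<Rightarrow> ('n, 'k) mpoly \<Rightarrow> ('n, 'k) mpoly"
    by unfold_locales (simp_all add: algebra_simps)
  have partials: "homogeneous e (partial i f)" for i
    using assms by (rule partial_homogeneous)
  have range: "range (\<lambda>v. directional v f) = mpoly.span (range (\<lambda>i. partial i f))"
    using mpoly.range_combination_eq_span[of "\<lambda>i. partial i f"]
    by (simp add: directional_def scale_def)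
  have "homogeneous_part e g \<in> mpoly.span (range (\<lambda>i. partial i f))"
    if "g \<in> gradient_ideal f" for g
    using that unfolding gradient_ideal_def
  proof (induction rule: ideal.span_induct_alt)
    case base
    have "homogeneous_part e (0 :: ('n, 'k) mpoly) = 0"
      using homogeneous_part_homogeneous[OF homogeneous_0, of e e] by simp
    then show ?case
      by (simp add: mpoly.span_zero)
  next
    case (step c x y)
    then obtain i where "x = partial i f"
      by auto
    then have "homogeneous_part e (c * x + y) =
        scale (Poly_Mapping.lookup c 0) (partial i f) + homogeneous_part e y"
      by (simp add: homogeneous_part_add homogeneous_part_mult_homogeneous[OF partials] scale_def)
    moreover have "scale (Poly_Mapping.lookup c 0) (partial i f) \<in> mpoly.span (range (\<lambda>i. partial i f))"
      by (intro mpoly.span_scale mpoly.span_base rangeI)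
    ultimately show ?case
      using step.IH by (simp add: mpoly.span_add)
  qed
  then have "g \<in> range (\<lambda>v. directional v f)" if "g \<in> gradient_ideal f" "homogeneous e g" for g
    using that homogeneous_part_homogeneous[OF that(2), of e] by (force simp: range)
  moreover have "directional v f \<in> gradient_ideal f" for v
    unfolding directional_def gradient_ideal_def
    by (intro ideal.span_sum ideal.span_scale ideal.span_base rangeI)
  moreover have "homogeneous e (directional v f)" for v
    unfolding directional_def
    using homogeneous_mult[OF homogeneous_Const partials] by (intro homogeneous_sum) simp
  ultimately show ?thesis
    by (auto simp: graded_piece_def)
qed

text \<open>
  Allowing the zero linear form merges the two conditions: a vanishing directional derivative is a
  linear dependence between the partial derivatives, which is what a wrong codimension means, and a
  directional derivative that is a nonzero square is a point of the Veronese variety.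
\<close>

lemma veronese_avoiding_3_iff:
  fixes f :: "(3, 'k::field) mpoly"
  assumes "homogeneous 3 f"
  shows "veronese_avoiding 3 f \<longleftrightarrow>
    (\<forall>v l. directional v f = (\<Sum>a\<in>UNIV. Const (l a) * Var a)\<^sup>2 \<longrightarrow> v = (\<lambda>_. 0))"
    (is "_ \<longleftrightarrow> ?R")
proof -
  define J where "J = range (\<lambda>v. directional v f)"
  let ?lin = "\<lambda>l. \<Sum>a\<in>UNIV. Const (l a) * Var a :: (3, 'k) mpoly"
  have comb: "directional v f = (\<Sum>i\<in>UNIV. scale (v i) (partial i f))" for v
    by (simp add: directional_def scale_def)
  have "gradient_ideal f \<inter> graded_piece 2 = J"
    using gradient_ideal_lowest_piece[of 2 f] assms by (simp add: J_def numeral_3_eq_3)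
  then have "veronese_avoiding 3 f \<longleftrightarrow>
      codim (graded_piece 2) J = 3 \<and> projectivization J \<inter> veronese 2 = {}"
    by (simp add: veronese_avoiding_def Let_def)
  moreover have "codim (graded_piece 2) J = 3 \<longleftrightarrow> mpoly.dim J = 3"
    by (simp add: codim_def dim_graded_piece card_quadratic_monomials_3)
  moreover have "mpoly.dim J = 3 \<longleftrightarrow> (\<forall>v. directional v f = 0 \<longrightarrow> v = (\<lambda>_. 0))"
    using mpoly.dim_range_combination_eq_card_iff[of "\<lambda>i. partial i f"]
    by (simp add: J_def comb)
  moreover have "(\<forall>v. directional v f = 0 \<longrightarrow> v = (\<lambda>_. 0)) \<and> projectivization J \<inter> veronese 2 = {}
      \<longleftrightarrow> ?R"
  proof
    assume L: "(\<forall>v. directional v f = 0 \<longrightarrow> v = (\<lambda>_. 0)) \<and> projectivization J \<inter> veronese 2 = {}"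
    show ?R
    proof (intro allI impI, rule ccontr)
      fix v l
      assume v: "directional v f = (?lin l)\<^sup>2" "v \<noteq> (\<lambda>_. 0)"
      with L have nz: "(?lin l)\<^sup>2 \<noteq> 0"
        by metis
      then have "mpoly.span {(?lin l)\<^sup>2} \<in> projectivization J"
        using v(1) unfolding projectivization_def J_def by (blast intro: sym)
      moreover from nz have "mpoly.span {(?lin l)\<^sup>2} \<in> veronese 2"
        using homogeneous_linear_form[of l] unfolding veronese_def graded_piece_def
        by (auto intro!: exI[of _ "?lin l"])
      ultimately show False
        using L by blast
    qed
  next
    assume R: ?R
    have "v = (\<lambda>_. 0)" if "directional v f = 0" for v
      using R[rule_format, of v "\<lambda>_. 0"] that by (simp add: Const_0)
    moreover have "projectivization J \<inter> veronese 2 = {}"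
    proof (rule ccontr)
      assume "projectivization J \<inter> veronese 2 \<noteq> {}"
      then obtain w l where w: "w \<in> J" "w \<noteq> 0" and l: "l \<in> graded_piece 1"
        and span: "mpoly.span {w} = mpoly.span {l\<^sup>2}"
        by (auto simp: projectivization_def veronese_def)
      have "mpoly.subspace J"
        using mpoly.range_combination_eq_span[of "\<lambda>i. partial i f"] by (simp add: J_def comb)
      with w(1) have "mpoly.span {w} \<subseteq> J"
        by (intro mpoly.span_minimal) auto
      with span have "l\<^sup>2 \<in> J"
        using mpoly.span_base[of "l\<^sup>2" "{l\<^sup>2}"] by auto
      then obtain v where v: "l\<^sup>2 = directional v f"
        by (auto simp: J_def)
      from l have "homogeneous 1 l"
        by (simp add: graded_piece_def)
      then obtain c where "l = ?lin c"
        by (rule linear_form_coefficients)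
      with v R have "v = (\<lambda>_. 0)"
        by metis
      with v have "l\<^sup>2 = 0"
        by (simp add: directional_def Const_0)
      with span have "w = 0"
        using mpoly.span_base[of w "{w}"] by auto
      with w show False
        by simp
    qed
    ultimately show "(\<forall>v. directional v f = 0 \<longrightarrow> v = (\<lambda>_. 0)) \<and> projectivization J \<inter> veronese 2 = {}"
      by blast
  qed
  ultimately show ?thesis
    by simp
qed

section \<open>Nodes and squares\<close>

text \<open>For expanding a sum over three indices when the argument has singled out two of them.\<close>

lemma UNIV_3_third:
  assumes "i \<noteq> (j :: 3)"
  obtains k where "k \<noteq> i" "k \<noteq> j" "UNIV = {i, j, k}"
proof -
  have "card (UNIV - {i, j}) = 1"
    using assms by (simp add: card_Diff_subset)
  then obtain k where "UNIV - {i, j} = {k}"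
    by (rule card_1_singletonE)
  then show ?thesis
    by (intro that[of k]) auto
qed

text \<open>
  Two independent kernel vectors make all columns multiples of one column, so by symmetry the
  matrix has the form \<open>Q\<^sub>b\<^sub>c = \<mu>\<^sub>b \<mu>\<^sub>c r\<close>, and \<open>r\<close> has a square root.
\<close>

lemma symmetric_matrix_rank_le_1_is_square:
  fixes Q :: "3 \<Rightarrow> 3 \<Rightarrow> 'k::alg_closed_field"
  assumes sym: "\<And>b c. Q b c = Q c b"
    and p: "\<And>b. (\<Sum>c\<in>UNIV. Q b c * p c) = 0" "p i \<noteq> 0"
    and u: "\<And>b. (\<Sum>c\<in>UNIV. Q b c * u c) = 0" "u i = 0" "u j \<noteq> 0"
  obtains l where "\<And>b c. Q b c = l b * l c"
proof -
  from u have "i \<noteq> j" by auto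
  then obtain k where k: "k \<noteq> i" "k \<noteq> j" "UNIV = {i, j, k}"
    by (rule UNIV_3_third)
  have sum: "(\<Sum>c\<in>UNIV. g c) = g i + g j + g k" for g :: "3 \<Rightarrow> 'k"
    unfolding k(3) using k(1,2) \<open>i \<noteq> j\<close> by (auto simp: add.assoc)
  define mj where "mj = - u k / u j"
  define mi where "mi = - (p j * mj + p k) / p i"
  define m where "m c = (if c = i then mi else if c = j then mj else 1)" for c
  have j: "Q b j = mj * Q b k" for b
    using u(1)[of b] u(2,3) by (simp add: sum mj_def field_simps eq_neg_iff_add_eq_0)
  have i: "Q b i = mi * Q b k" for b
  proof -
    have "Q b i * p i = - (p j * mj + p k) * Q b k"
      using p(1)[of b] by (simp add: sum j algebra_simps eq_neg_iff_add_eq_0)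
    with p(2) show ?thesis
      by (simp add: mi_def field_simps)
  qed
  have m: "Q b c = m c * Q b k" for b c
    using i j k by (cases "c = i"; cases "c = j") (auto simp: m_def)
  obtain r where r: "r\<^sup>2 = Q k k"
    using nth_root_exists[of 2 "Q k k"] by auto
  have "Q b c = (m b * r) * (m c * r)" for b c
  proof -
    have "Q b c = m c * (m b * Q k k)"
      using m[of b c] m[of k b] sym[of b k] by simp
    then show ?thesis
      by (simp add: power2_eq_square mult_ac flip: r)
  qed
  then show ?thesis
    by (rule that)
qed

text \<open>
  If \<open>p\<close> is a singular point but not a node, then \<open>F(p, \<cdot>, \<cdot>)\<close> has rank at most one, so the derivative
  of the cubic in the direction \<open>p\<close> is a square.
\<close>

lemma nonnode_directional_is_square:
  fixes C :: "3 \<Rightarrow> 3 \<Rightarrow> 3 \<Rightarrow> 'k::{alg_closed_field, field_char_0}"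
  assumes C: "symmetric_tensor C"
    and p: "singular_point (cubic_form C) p" and "\<not> node (cubic_form C) p"
  obtains l where "directional (($) p) (cubic_form C) = (\<Sum>a\<in>UNIV. Const (l a) * Var a)\<^sup>2"
proof -
  let ?F = "trilinear C"
  from p have "p \<noteq> 0" and pp: "?F (($) p) (($) p) w = 0" for w
    by (simp_all add: singular_point_cubic_form_iff[OF C])
  from \<open>p \<noteq> 0\<close> obtain i where i: "p $ i \<noteq> 0"
    by (auto simp: vec_eq_iff)
  obtain u0 where u0: "\<And>w. ?F (($) p) u0 w = 0" and not_multiple: "\<nexists>c. u0 = (\<lambda>a. c * p $ a)"
    using assms(3) by (auto simp: node_cubic_form_iff[OF C p])
  define c0 where "c0 = u0 i / p $ i"
  define u where "u = (\<lambda>a. u0 a + (- c0) * p $ a)"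
  have u: "?F (($) p) u w = 0" for w
    using u0 pp by (simp only: u_def trilinear_add_2 trilinear_scale_2) simp
  have "u i = 0"
    using i by (simp add: u_def c0_def)
  have "\<exists>j. u j \<noteq> 0"
  proof (rule ccontr)
    assume "\<nexists>j. u j \<noteq> 0"
    then have "u0 = (\<lambda>a. c0 * p $ a)"
      by (simp add: u_def fun_eq_iff)
    with not_multiple show False
      by blast
  qed
  then obtain j where "u j \<noteq> 0" ..
  define Q where "Q b c = 3 * (\<Sum>a\<in>UNIV. p $ a * C a b c)" for b c
  have Q_sym: "Q b c = Q c b" for b c
    using C by (simp add: Q_def symmetric_tensor_def)
  have Q: "(\<Sum>c\<in>UNIV. Q b c * x c) = 3 * ?F (($) p) x (\<lambda>a. if a = b then 1 else 0)" for b x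
  proof -
    have "?F (($) p) x (\<lambda>a. if a = b then 1 else 0) = ?F (($) p) (\<lambda>a. if a = b then 1 else 0) x"
      by (rule trilinear_swap_23[OF C])
    also have "\<dots> = (\<Sum>d\<in>UNIV. \<Sum>c\<in>UNIV. if d = b then (\<Sum>a\<in>UNIV. p $ a * C a d c) * x c else 0)"
      unfolding trilinear_contract by (intro sum.cong refl) simp
    also have "\<dots> = (\<Sum>d\<in>UNIV. if d = b then (\<Sum>c\<in>UNIV. (\<Sum>a\<in>UNIV. p $ a * C a d c) * x c) else 0)"
      by (rule sum.cong) auto
    also have "\<dots> = (\<Sum>c\<in>UNIV. (\<Sum>a\<in>UNIV. p $ a * C a b c) * x c)"
      by simp
    finally show ?thesis
      by (simp add: Q_def sum_distrib_left sum_distrib_right mult.assoc)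
  qed
  obtain l where l: "\<And>b c. Q b c = l b * l c"
    using symmetric_matrix_rank_le_1_is_square[of Q "($) p" i u j] Q_sym Q pp u i
      \<open>u i = 0\<close> \<open>u j \<noteq> 0\<close> by auto
  have "directional (($) p) (cubic_form C) = (\<Sum>b\<in>UNIV. \<Sum>c\<in>UNIV. Const (Q b c) * Var b * Var c)"
    by (simp add: directional_cubic_form[OF C] trilinear_contract Q_def Const_mult Const_sum
        sum_distrib_left sum_distrib_right mult.assoc)
  also have "\<dots> = (\<Sum>a\<in>UNIV. Const (l a) * Var a)\<^sup>2"
    by (simp add: l power2_eq_square sum_product Const_mult mult_ac)
  finally show ?thesis
    by (rule that)
qed

text \<open>
  Conversely let \<open>3 F(v, x, x) = l(x)\<^sup>2\<close> with \<open>v \<noteq> 0\<close>; polarization gives \<open>3 F(v, x, y) = l(x) l(y)\<close>.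
  If \<open>l(v) = 0\<close>, then \<open>v\<close> itself is a singular point, and \<open>F(v, \<cdot>, \<cdot>)\<close> has rank at most one there.
  If \<open>l(v) \<noteq> 0\<close>, then any singular point \<open>p\<close> satisfies \<open>l(p)\<^sup>2 = 3 F(p, p, v) = 0\<close>, so that
  \<open>3 F(p, v, y) = l(p) l(y) = 0\<close> for all \<open>y\<close>, and \<open>v\<close> is a kernel vector of \<open>F(p, \<cdot>, \<cdot>)\<close> which
  is not a multiple of \<open>p\<close>.
\<close>

lemma square_directional_imp_nonnode:
  fixes C :: "3 \<Rightarrow> 3 \<Rightarrow> 3 \<Rightarrow> 'k::field_char_0"
  assumes C: "symmetric_tensor C" and p: "singular_point (cubic_form C) p"
    and v: "v \<noteq> (\<lambda>_. 0)"
    and square: "directional v (cubic_form C) = (\<Sum>a\<in>UNIV. Const (l a) * Var a)\<^sup>2"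
  shows "\<not> nodal (cubic_form C)"
proof
  assume nodal: "nodal (cubic_form C)"
  let ?F = "trilinear C"
  define L where "L x = (\<Sum>a\<in>UNIV. l a * x a)" for x
  have L_add: "L (\<lambda>a. x a + y a) = L x + L y" for x y
    by (simp add: L_def distrib_left sum.distrib)
  have square_at: "3 * ?F v x x = (L x)\<^sup>2" for x
  proof -
    have "(($) (\<chi> a. x a)) = x"
      by auto
    then have "3 * ?F v x x = eval_at (directional v (cubic_form C)) (\<chi> a. x a)"
      by (simp only: eval_at_directional_cubic_form[OF C])
    also have "\<dots> = (L x)\<^sup>2"
      by (simp add: square power2_eq_square eval_at_mult eval_at_sum eval_at_Const eval_at_Var L_def)
    finally show ?thesis .
  qed
  have polar: "3 * ?F v x y = L x * L y" for x y
  proof -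
    have "?F v (\<lambda>a. x a + y a) (\<lambda>a. x a + y a) = ?F v x x + ?F v y y + 2 * ?F v x y"
      using trilinear_swap_23[OF C, of v x y] by (simp add: trilinear_add_2 trilinear_add_3)
    then have "3 * ?F v x x + 3 * ?F v y y + 2 * (3 * ?F v x y) = (L x + L y)\<^sup>2"
      using square_at[of "\<lambda>a. x a + y a"] by (simp add: L_add algebra_simps)
    then have "2 * (3 * ?F v x y) = 2 * (L x * L y)"
      by (simp add: square_at power2_sum)
    then show ?thesis
      by (metis mult_left_cancel zero_neq_numeral)
  qed
  then have zero: "?F v x y = 0 \<longleftrightarrow> L x = 0 \<or> L y = 0" for x y
    by (metis mult_eq_0_iff zero_neq_numeral)
  show False
  proof (cases "L v = 0")
    case True
    define q :: "'k ^ 3" where "q = (\<chi> a. v a)"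
    have q: "(($) q) = v"
      by (auto simp: q_def)
    have "q \<noteq> 0"
      using v by (auto simp: q_def vec_eq_iff)
    then have sing: "singular_point (cubic_form C) q"
      by (simp add: singular_point_cubic_form_iff[OF C] q zero True)
    from v obtain i where i: "v i \<noteq> 0"
      by auto
    have "\<exists>j. j \<noteq> i"
      by (metis zero_neq_one)
    then obtain j where "i \<noteq> j"
      by metis
    then obtain k where k: "k \<noteq> i" "k \<noteq> j" "UNIV = {i, j, k}"
      by (rule UNIV_3_third)
    \<comment> \<open>A nonzero zero of \<open>L\<close> in the plane of the vectors with vanishing \<open>i\<close>-th coordinate.\<close>
    define u where "u a = (if a = i then 0 else if l j = 0 then (if a = j then 1 else 0)
      else if a = j then l k else - l j)" for a
    have "L u = 0"
    proof -
      have "L u = l i * u i + l j * u j + l k * u k"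
        unfolding L_def k(3) using k(1,2) \<open>i \<noteq> j\<close> by (auto simp: add.assoc)
      also have "\<dots> = 0"
        using k \<open>i \<noteq> j\<close> by (simp add: u_def)
      finally show ?thesis .
    qed
    then have "\<forall>w. ?F (($) q) u w = 0"
      by (simp add: q zero)
    moreover have "node (cubic_form C) q"
      using nodal sing by (simp add: nodal_def)
    ultimately obtain c where c: "u = (\<lambda>a. c * v a)"
      using node_cubic_form_iff[OF C sing] q by auto
    have "u i = 0"
      by (simp add: u_def)
    with c i have "c = 0"
      by simp
    then have "u j = 0" "u k = 0"
      by (simp_all add: c)
    then show False
      using k \<open>i \<noteq> j\<close> by (simp add: u_def split: if_splits)
  next
    case False
    have pp: "?F (($) p) (($) p) w = 0" for w
      using p by (simp add: singular_point_cubic_form_iff[OF C])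
    have "?F v (($) p) (($) p) = ?F (($) p) (($) p) v"
      using trilinear_swap_12[OF C, of v "($) p" "($) p"]
        trilinear_swap_23[OF C, of "($) p" v "($) p"] by simp
    then have Lp: "L (($) p) = 0"
      using zero[of "($) p" "($) p"] pp by simp
    have "?F (($) p) v w = 0" for w
      using trilinear_swap_12[OF C, of "($) p" v w] zero[of "($) p" w] Lp by simp
    moreover have "node (cubic_form C) p"
      using nodal p by (simp add: nodal_def)
    ultimately obtain c where "v = (\<lambda>a. c * p $ a)"
      using node_cubic_form_iff[OF C p] by auto
    then have "L v = c * L (($) p)"
      by (simp add: L_def sum_distrib_left mult_ac)
    with Lp False show False
      by simp
  qed
qed

theorem proposition2p14:
  fixes f :: "(3, 'k::{alg_closed_field, field_char_0}) mpoly"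
  assumes "homogeneous 3 f"
    and "squarefree f"
    and "singular f"
  shows "veronese_avoiding 3 f \<longleftrightarrow> nodal f"
proof -
  obtain C where C: "symmetric_tensor C" and f: "f = cubic_form C"
    using assms(1) by (rule homogeneous_3_is_symmetric_cubic_form)
  from assms(3) obtain p where p: "singular_point f p"
    by (auto simp: singular_def)
  show ?thesis
  proof
    assume va: "veronese_avoiding 3 f"
    show "nodal f"
      unfolding nodal_def
    proof (intro allI impI, rule ccontr)
      fix q
      assume q: "singular_point f q" "\<not> node f q"
      then obtain l where "directional (($) q) f = (\<Sum>a\<in>UNIV. Const (l a) * Var a)\<^sup>2"
        unfolding f by (rule nonnode_directional_is_square[OF C])
      with va have "($) q = (\<lambda>_. 0)"
        unfolding veronese_avoiding_3_iff[OF assms(1)] by blast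
      then have "q = 0"
        by (simp add: vec_eq_iff fun_eq_iff)
      with q show False
        by (simp add: singular_point_def)
    qed
  next
    assume "nodal f"
    then show "veronese_avoiding 3 f"
      unfolding veronese_avoiding_3_iff[OF assms(1)]
      using square_directional_imp_nonnode[OF C] p by (auto simp: f)
  qed
qed

end
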